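(* Let $m\ge 2$ and $r\ge 0$ be two integers, and let $A$ and $B$ be two sets with $A\cup B=\mathbb{N}\setminus\{r+mk : k\in\mathbb{N}\}$ and $A\cap B=\emptyset$. Then $R_A(n)=R_B(n)$ for every positive integer $n$ if and only if $A=S_1(l)$, $B=T_1(l)$, or $A=S_2(l)$, $B=T_2(l)$, or $A=S_1(l)+1$, $B=T_1(l)+1$, where $l$ is a nonnegative integer.
   Context: $\mathbb{N}$ is the set of all nonnegative integers. For $S\subseteq\mathbb{N}$ and $n\in\mathbb{N}$, $R_S(n)$ is the number of solutions of $n=s+s'$ with $s,s'\in S$ and $s<s'$. For $S\subseteq\mathbb{N}$, $S+1=\{s+1: s\in S\}$. For a sequence $h_1,h_2,\ldots$ of positive integers, let $H_0(h_1,h_2,\ldots)$ be the set of all sums $\sum_i \varepsilon_i h_i$ with $\varepsilon_i\in\{0,1\}$, $\sum_i\varepsilon_i h_i<+\infty$ and $\sum_i\varepsilon_i$ even, and let $H_1(h_1,h_2,\ldots)$ be the set of all sums $\sum_i \varepsilon_i h_i$ with $\varepsilon_i\in\{0,1\}$, $\sum_i\varepsilon_i h_i<+\infty$ and $\sum_i\varepsilon_i$ odd. For a nonnegative integer $l$: - $S_1(l)=H_0(h_1,h_2,\ldots)$ and $T_1(l)=H_1(h_1,h_2,\ldots)$, where $h_i=2^{i-1}$ for $1\le i\le l$ and $h_{l+j}=2^{j-1}(2^l+1)$ for $j\ge 1$. - $S_2(l)=H_0(h_1,h_2,\ldots)$ and $T_2(l)=H_1(h_1,h_2,\ldots)$,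 where $h_i=2^{i-1}$ for $1\le i\le l-1$, $h_l=2^{l-1}+1$ (if $l\ge 1$), and $h_{l+j}=2^{j-1}(2^l+1)$ for $j\ge 1$. (For $l=0$ the sequence is just $h_j=2^{j-1}\cdot 2$, $j\ge 1$.)
   Formalization: The classification is proved up to interchanging A and B: one of the ordered pairs (A,B), (B,A) is in the list. As an ordered statement it is false, e.g. m=2, r=1, A=T_1(0), B=S_1(0). *)

theory Defs
  imports Main
begin

definition rep_count :: "nat set \<Rightarrow> nat \<Rightarrow> nat" where
  "rep_count S n = card {(s, s'). s \<in> S \<and> s' \<in> S \<and> s < s' \<and> n = s + s'}"

text \<open>A sequence \<open>h\<^sub>1, h\<^sub>2, \<dots>\<close> of positive integers is a function on \<^typ>\<open>nat\<close> of which only the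
  values at indices \<open>i \<ge> 1\<close> matter. The finite set \<open>I\<close> is the set of indices with \<open>\<epsilon>\<^sub>i = 1\<close>:
  since every \<open>h\<^sub>i\<close> is positive, \<open>\<Sum> \<epsilon>\<^sub>i h\<^sub>i < \<infinity>\<close> says exactly that this set is finite, and
  \<open>\<Sum> \<epsilon>\<^sub>i\<close> is its cardinality.\<close>

definition H0 :: "(nat \<Rightarrow> nat) \<Rightarrow> nat set" where
  "H0 h = {\<Sum>i\<in>I. h i | I. finite I \<and> I \<subseteq> {1..} \<and> even (card I)}"

definition H1 :: "(nat \<Rightarrow> nat) \<Rightarrow> nat set" where
  "H1 h = {\<Sum>i\<in>I. h i | I. finite I \<and> I \<subseteq> {1..} \<and> odd (card I)}"

text \<open>For \<open>i = l + j\<close> with \<open>j \<ge> 1\<close>, the exponent \<open>i - l - 1\<close> below is \<open>j - 1\<close>; for \<open>i \<ge> 1\<close> no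
  truncated subtraction occurs in the branch that is selected.\<close>

definition seq1 :: "nat \<Rightarrow> nat \<Rightarrow> nat" where
  "seq1 l i = (if i \<le> l then 2 ^ (i - 1) else 2 ^ (i - l - 1) * (2 ^ l + 1))"

definition seq2 :: "nat \<Rightarrow> nat \<Rightarrow> nat" where
  "seq2 l i = (if i < l then 2 ^ (i - 1)
               else if i = l then 2 ^ (l - 1) + 1
               else 2 ^ (i - l - 1) * (2 ^ l + 1))"

definition S1 :: "nat \<Rightarrow> nat set" where "S1 l = H0 (seq1 l)"
definition T1 :: "nat \<Rightarrow> nat set" where "T1 l = H1 (seq1 l)"
definition S2 :: "nat \<Rightarrow> nat set" where "S2 l = H0 (seq2 l)"
definition T2 :: "nat \<Rightarrow> nat set" where "T2 l = H1 (seq2 l)"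

definition shift1 :: "nat set \<Rightarrow> nat set" where
  "shift1 S = {s + 1 | s. s \<in> S}"

text \<open>\<open>in_list\<close> concerns ordered pairs: in each of the three families \<open>A\<close> contains the least element
  of \<open>A \<union> B\<close>. As \<open>R\<^sub>A = R\<^sub>B\<close> is symmetric in \<open>A\<close> and \<open>B\<close>, a classification without that
  normalisation must use \<open>in_list A B \<or> in_list B A\<close>.\<close>

definition in_list :: "nat set \<Rightarrow> nat set \<Rightarrow> bool" where
  "in_list A B \<longleftrightarrow> (\<exists>l. (A = S1 l \<and> B = T1 l) \<or>
                        (A = S2 l \<and> B = T2 l) \<or>
                        (A = shift1 (S1 l) \<and> B = shift1 (T1 l)))"

end

theory Submission
  imports Defs "HOL-Library.Nat_Bijection" "HOL-Computational_Algebra.Fundamental_Theorem_Algebra"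
begin

text \<open>Let \<open>F\<close> and \<open>D\<close> be the generating functions of \<open>A \<union> B\<close> and of \<open>d = 1\<^sub>A - 1\<^sub>B\<close>. Then
  \<open>R\<^sub>A = R\<^sub>B\<close> amounts to \<open>F(z) D(z) = D(z\<^sup>2)\<close>, so \<open>A \<union> B\<close> determines \<open>d\<close> up to sign when it contains
  \<open>0\<close>; the case \<open>r = 0\<close> is the case \<open>r = m - 1\<close> translated by one.

  Let \<open>r \<ge> 1\<close>. As \<open>d\<close> is bounded, the functional equation forbids zeros of \<open>F\<close> in the unit disc. Now
  \<open>(1 - z) (1 - z\<^sup>m) F(z) = 1 - z\<^sup>r + z\<^bsup>r+1\<^esup> - z\<^sup>m\<close>, and unless \<open>m = r + 1\<close> the right-hand side has constant and
  leading coefficients of modulus \<open>1\<close>. Hence its roots all lie on the unit circle and it is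
  self-reciprocal up to a constant, which forces \<open>m = 2 r + 1\<close>. In both cases \<open>r < m\<close>, so \<open>d\<close> is,
  up to sign, the Thue--Morse sequence below \<open>r\<close>, and \<open>|d| \<le> 1\<close> between \<open>r\<close> and \<open>2 r\<close> forces a
  self-similarity of that sequence which holds only if \<open>r\<close> is a power of two. The sets \<open>S\<^sub>1(l)\<close>, \<open>T\<^sub>1(l)\<close> and
  \<open>S\<^sub>2(l)\<close>, \<open>T\<^sub>2(l)\<close> solve the remaining cases, and uniqueness of \<open>d\<close> concludes.\<close>

subsection \<open>Generating functions\<close>

text \<open>The reflection \<open>i \<mapsto> n - i\<close> pairs the solutions with smaller first
  summand with those with larger first summand; only its fixed point \<open>2 * i = n\<close> is
  left out.\<close>

lemma two_rep_count:
  "2 * rep_count S n = card {i. i \<le> n \<and> i \<in> S \<and> n - i \<in> S \<and> 2 * i \<noteq> n}"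
proof -
  let ?L = "{i. i \<le> n \<and> i \<in> S \<and> n - i \<in> S \<and> 2 * i < n}"
  let ?G = "{i. i \<le> n \<and> i \<in> S \<and> n - i \<in> S \<and> n < 2 * i}"
  have "bij_betw (\<lambda>i. (i, n - i)) ?L {(s, s'). s \<in> S \<and> s' \<in> S \<and> s < s' \<and> n = s + s'}"
    by (rule bij_betw_byWitness[where f' = fst]) auto
  then have L: "card ?L = rep_count S n"
    unfolding rep_count_def by (rule bij_betw_same_card)
  have "bij_betw (\<lambda>i. n - i) ?L ?G"
    by (rule bij_betw_byWitness[where f' = "\<lambda>i. n - i"]) auto
  then have G: "card ?L = card ?G"
    by (rule bij_betw_same_card)
  have "{i. i \<le> n \<and> i \<in> S \<and> n - i \<in> S \<and> 2 * i \<noteq> n} = ?L \<union> ?G"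
    by auto
  moreover have "card (?L \<union> ?G) = card ?L + card ?G"
    by (rule card_Un_disjoint) (auto intro: finite_subset[of _ "{..n}"])
  ultimately show ?thesis
    using L G by simp
qed

text \<open>Coefficient form of \<open>2 R(z) + S(z\<^sup>2) = S(z)\<^sup>2\<close>; the
  \<open>of_bool\<close> term on the left is the diagonal solution \<open>s = s'\<close>.\<close>

lemma rep_count_convolution:
  "2 * int (rep_count S n) + of_bool (even n \<and> n div 2 \<in> S)
     = (\<Sum>i\<le>n. of_bool (i \<in> S) * of_bool (n - i \<in> S))"
proof -
  let ?Q = "{i. i \<le> n \<and> i \<in> S \<and> n - i \<in> S}"
  let ?N = "{i. i \<le> n \<and> i \<in> S \<and> n - i \<in> S \<and> 2 * i \<noteq> n}"
  let ?H = "{i. i \<le> n \<and> i \<in> S \<and> n - i \<in> S \<and> 2 * i = n}"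
  have "(\<Sum>i\<le>n. of_bool (i \<in> S) * of_bool (n - i \<in> S)) = (\<Sum>i\<le>n. if i \<in> ?Q then 1 else 0 :: int)"
    by (rule sum.cong) auto
  also have "\<dots> = int (card ?Q)"
    by (subst sum.inter_restrict[symmetric]) (auto intro!: arg_cong[where f = card])
  also have "?Q = ?N \<union> ?H"
    by auto
  also have "card (?N \<union> ?H) = card ?N + card ?H"
    by (rule card_Un_disjoint) (auto intro: finite_subset[of _ "{..n}"])
  also have "?H = (if even n \<and> n div 2 \<in> S then {n div 2} else {})"
    by (auto elim!: evenE)
  also have "card ?N = 2 * rep_count S n"
    by (rule two_rep_count[symmetric])
  finally show ?thesis
    by auto
qed

definition signed_ind :: "'a set \<Rightarrow> 'a set \<Rightarrow> 'a \<Rightarrow> int" where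
  "signed_ind A B x = of_bool (x \<in> A) - of_bool (x \<in> B)"

text \<open>In terms of the generating functions \<open>F\<close> of \<open>U\<close> and \<open>D\<close> of \<open>d\<close>, this says
  \<open>F(z) D(z) = D(z\<^sup>2)\<close>.\<close>

definition doubling :: "nat set \<Rightarrow> (nat \<Rightarrow> int) \<Rightarrow> bool" where
  "doubling U d \<longleftrightarrow>
     (\<forall>n. (\<Sum>i\<le>n. of_bool (n - i \<in> U) * d i) = (if even n then d (n div 2) else 0))"

text \<open>The difference of the convolution identities for \<open>A\<close> and \<open>B\<close>
  factors as \<open>a\<^sup>2 - b\<^sup>2 = (a + b) (a - b)\<close>; disjointness makes
  \<open>a + b\<close> the indicator of the union, and the diagonals leave the term at
  \<open>n div 2\<close>.\<close>

lemma rep_count_eq_iff: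
  assumes "A \<inter> B = {}"
  shows "rep_count A n = rep_count B n \<longleftrightarrow>
    (\<Sum>i\<le>n. of_bool (n - i \<in> A \<union> B) * signed_ind A B i)
      = (if even n then signed_ind A B (n div 2) else 0)"
proof -
  define a b :: "nat \<Rightarrow> int" where "a i = of_bool (i \<in> A)" and "b i = of_bool (i \<in> B)" for i
  have u: "of_bool (i \<in> A \<union> B) = a i + b i" for i
    using assms by (auto simp: a_def b_def)
  have cross: "(\<Sum>i\<le>n. b (n - i) * a i) = (\<Sum>i\<le>n. a (n - i) * b i)"
    by (rule sum.reindex_bij_witness[where i = "\<lambda>i. n - i" and j = "\<lambda>i. n - i"]) auto
  have "(\<Sum>i\<le>n. of_bool (n - i \<in> A \<union> B) * signed_ind A B i)
      = (\<Sum>i\<le>n. a i * a (n - i) - b i * b (n - i) + (b (n - i) * a i - a (n - i) * b i))"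
    unfolding u by (rule sum.cong) (auto simp: signed_ind_def a_def b_def)
  also have "\<dots> = (\<Sum>i\<le>n. a i * a (n - i)) - (\<Sum>i\<le>n. b i * b (n - i))"
    by (simp add: sum.distrib sum_subtractf cross)
  also have "\<dots> = 2 * (int (rep_count A n) - int (rep_count B n))
                  + (if even n then signed_ind A B (n div 2) else 0)"
    unfolding a_def b_def rep_count_convolution[symmetric] by (auto simp: signed_ind_def)
  finally show ?thesis
    by auto
qed

lemma rep_count_eq_iff_doubling:
  assumes "A \<inter> B = {}"
  shows "(\<forall>n. rep_count A n = rep_count B n) \<longleftrightarrow> doubling (A \<union> B) (signed_ind A B)"
  unfolding doubling_def using rep_count_eq_iff[OF assms] by simp

text \<open>Since \<open>0 \<in> U\<close>, the summand \<open>i = n\<close> is \<open>d n\<close>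
  itself, so for positive \<open>n\<close> the identity expresses \<open>d n\<close> through smaller
  indices. At \<open>n = 0\<close> it is trivial, hence the prescribed initial value.\<close>

lemma doubling_unique:
  assumes "doubling U d" "doubling U d'" "0 \<in> U" "d 0 = d' 0"
  shows "d = d'"
proof
  fix n
  show "d n = d' n"
  proof (induction n rule: less_induct)
    case (less n)
    show ?case
    proof (cases "n = 0")
      case False
      have rec: "e n = (if even n then e (n div 2) else 0) - (\<Sum>i<n. of_bool (n - i \<in> U) * e i)"
        if "doubling U e" for e
        using that[unfolded doubling_def, rule_format, of n] \<open>0 \<in> U\<close>
        by (simp add: lessThan_Suc_atMost[symmetric])
      have "(\<Sum>i<n. of_bool (n - i \<in> U) * d i) = (\<Sum>i<n. of_bool (n - i \<in> U) * d' i)"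
        by (rule sum.cong) (auto simp: less)
      with False less show ?thesis
        by (simp add: rec[OF assms(1)] rec[OF assms(2)])
    qed (use assms in simp)
  qed
qed

subsection \<open>The Thue--Morse sequence\<close>

text \<open>The value is \<open>(-1) ^ s\<close> with \<open>s\<close> the number of ones in the
  binary expansion of \<open>n\<close>.\<close>

fun thue_morse :: "nat \<Rightarrow> int" where
  "thue_morse n = (if n = 0 then 1 else if even n then thue_morse (n div 2) else - thue_morse (n div 2))"

declare thue_morse.simps [simp del]

lemma thue_morse_0 [simp]: "thue_morse 0 = 1"
  by (subst thue_morse.simps) simp

lemma thue_morse_even [simp]: "thue_morse (2 * n) = thue_morse n"
  by (subst thue_morse.simps) simp

lemma thue_morse_odd [simp]: "thue_morse (Suc (2 * n)) = - thue_morse n"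
  by (subst thue_morse.simps) simp

lemma thue_morse_cases: "thue_morse n = 1 \<or> thue_morse n = -1"
proof (induction n rule: less_induct)
  case (less n)
  show ?case
  proof (cases "n = 0")
    case False
    then have "thue_morse (n div 2) = 1 \<or> thue_morse (n div 2) = -1"
      by (intro less.IH) simp
    then show ?thesis
      by (subst (1 2) thue_morse.simps) auto
  qed simp
qed

text \<open>An even \<open>N\<close> is halved by restricting to even \<open>j\<close>. For odd
  \<open>N > 1\<close> the values at \<open>N + 1\<close> and \<open>N + 2\<close> have opposite
  signs, whereas \<open>thue_morse 1 = thue_morse 2\<close> would make them equal; only
  \<open>N = 1\<close> remains.\<close>

lemma thue_morse_translate:
  assumes "N > 0" "\<And>j. j < N \<Longrightarrow> thue_morse (N + j) = c * thue_morse j"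
  shows "c = -1 \<and> (\<exists>k. N = 2 ^ k)"
  using assms
proof (induction N rule: less_induct)
  case (less N)
  show ?case
  proof (cases "even N")
    case True
    then obtain M where M: "N = 2 * M" by blast
    have "thue_morse (M + j) = c * thue_morse j" if "j < M" for j
      using less.prems(2)[of "2 * j"] that M thue_morse_even[of "M + j"] by simp
    then have "c = -1 \<and> (\<exists>k. M = 2 ^ k)"
      using less.prems M by (intro less.IH) auto
    then show ?thesis
      unfolding M by (metis power_Suc)
  next
    case False
    then obtain M where M: "N = Suc (2 * M)" by (metis oddE Suc_eq_plus1)
    have tm1: "thue_morse 1 = -1" and tm2: "thue_morse 2 = -1"
      using thue_morse_even[of 1] thue_morse_odd[of 0] by simp_all
    show ?thesis
    proof (cases "M = 0")
      case True
      with less.prems(2)[of 0] tm1 M have "c = -1" by simp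
      with True M show ?thesis by (intro conjI exI[of _ 0]) auto
    next
      case False
      have "thue_morse (2 * Suc M) = - c" "thue_morse (Suc (2 * Suc M)) = - c"
        using less.prems(2)[of 1] less.prems(2)[of 2] False M tm1 tm2 by simp_all
      then have "c = 0" by (simp only: thue_morse_even thue_morse_odd)
      moreover have "thue_morse N = c" using less.prems(2)[of 0] less.prems(1) by simp
      ultimately show ?thesis using thue_morse_cases[of N] by simp
    qed
  qed
qed

lemma power_of_two_if_doubling:
  fixes m r :: nat
  assumes dbl: "doubling (- {r + m * k | k. True}) d"
    and r: "0 < r" "r < m"
    and d: "d 0 = 1" "d r = 0" "\<And>n. \<bar>d n\<bar> \<le> 1"
  shows "\<exists>k. r = 2 ^ k"
proof -
  define e where "e n = (if even n then d (n div 2) else 0)" for n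
  \<comment> \<open>Below degree \<open>r + m\<close> the only exponent missing from the set is
    \<open>r\<close>, so there \<open>F(z)\<close> agrees with
    \<open>1 / (1 - z) - z\<^sup>r\<close>.\<close>
  have partial: "(\<Sum>i\<le>n. d i) = e n + (if n < r then 0 else d (n - r))" if n: "n < r + m" for n
  proof -
    have mem: "n - i \<in> - {r + m * k | k. True} \<longleftrightarrow> n - i \<noteq> r" for i
    proof -
      have "k = 0" if "n - i = r + m * k" for k
      proof (rule ccontr)
        assume "k \<noteq> 0"
        then have "m * 1 \<le> m * k" by (intro mult_le_mono) auto
        with that n show False by linarith
      qed
      then show ?thesis by fastforce
    qed
    have "(\<Sum>i\<le>n. d i) = (\<Sum>i\<le>n. of_bool (n - i \<noteq> r) * d i + (if i + r = n then d i else 0))"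
      using r by (intro sum.cong) auto
    also have "\<dots> = e n + (\<Sum>i\<le>n. if i + r = n then d i else 0)"
      using dbl[unfolded doubling_def, rule_format, of n] unfolding mem
      by (simp add: sum.distrib e_def)
    also have "(\<Sum>i\<le>n. if i + r = n then d i else 0) = (if n < r then 0 else d (n - r))"
    proof (cases "n < r")
      case False
      then have "(\<Sum>i\<le>n. if i + r = n then d i else 0) = (\<Sum>i\<le>n. if i = n - r then d i else 0)"
        by (intro sum.cong) auto
      with False show ?thesis by simp
    qed (auto intro!: sum.neutral)
    finally show ?thesis .
  qed
  have step: "d (Suc n) = e (Suc n) - e n + (if Suc n < r then 0 else d (Suc n - r))
      - (if n < r then 0 else d (n - r))" if "Suc n < r + m" for n
    using partial[of "Suc n"] partial[of n] that by simp
  \<comment> \<open>Before the shifted terms set in, the recursion reads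
    \<open>d (2 * k + 1) = - d k\<close> and \<open>d (2 * k + 2) = d (k + 1)\<close>.\<close>
  have tm: "d n = thue_morse n" if "n < r" for n
    using that
  proof (induction n rule: less_induct)
    case (less n)
    consider "n = 0" | k where "n = Suc (2 * k)" | k where "n = Suc (Suc (2 * k))"
      by (metis oddE evenE Suc_eq_plus1 not0_implies_Suc even_Suc)
    then show ?case
    proof cases
      case 1
      with d show ?thesis by simp
    next
      case 2
      then show ?thesis using step[of "2 * k"] less by (simp add: e_def)
    next
      case 3
      then show ?thesis using step[of "Suc (2 * k)"] less thue_morse_even[of "Suc k"]
        by (simp add: e_def)
    qed
  qed
  have tail: "d (Suc (r + n)) = e (Suc (r + n)) - e (r + n) + d (Suc n) - d n" if "Suc n < m" for n
    using step[of "r + n"] that by simp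
  show ?thesis
  proof (cases "even r")
    case True
    then obtain q where q: "r = 2 * q" by blast
    \<comment> \<open>The difference \<open>d (2 * j + 1) - d (2 * j)\<close> contributes
      \<open>- 2 * thue_morse j\<close>, and \<open>\<bar>d n\<bar> \<le> 1\<close> fixes the sign
      of the remaining term.\<close>
    have "thue_morse (q + j) = -1 * thue_morse j" if "j < q" for j
    proof -
      have "d (Suc (r + 2 * j)) = - thue_morse (q + j) - 2 * thue_morse j"
        using tail[of "2 * j"] that r q by (simp add: e_def tm)
      with d(3)[of "Suc (r + 2 * j)"] thue_morse_cases[of j] thue_morse_cases[of "q + j"]
      show ?thesis by auto
    qed
    then have "\<exists>k. q = 2 ^ k"
      using thue_morse_translate[of q "-1"] r q by auto
    then show ?thesis
      unfolding q by (metis power_Suc)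
  next
    case False
    then obtain q where q: "r = Suc (2 * q)" by (metis oddE Suc_eq_plus1)
    show ?thesis
    proof (cases "q = 0")
      case True
      with q show ?thesis by (intro exI[of _ 0]) simp
    next
      case False
      have shift: "thue_morse (Suc q + j) = thue_morse j" if "j < q" for j
      proof -
        have "d (Suc (r + 2 * j)) = thue_morse (Suc q + j) - 2 * thue_morse j"
          using tail[of "2 * j"] that r q by (simp add: e_def tm)
        with d(3)[of "Suc (r + 2 * j)"] thue_morse_cases[of j] thue_morse_cases[of "Suc q + j"]
        show ?thesis by auto
      qed
      \<comment> \<open>This is the hypothesis \<open>d r = 0\<close>, read through the recursion at
        \<open>r = 2 * q + 1\<close>.\<close>
      have q1: "thue_morse q = 1"
        using step[of "2 * q"] r q d False by (simp add: e_def tm)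
      have "odd q"
      proof
        assume "even q"
        then have "thue_morse (Suc q) = - thue_morse q"
          by (elim evenE) simp
        with q1 shift[of 0] False show False by simp
      qed
      then obtain M where M: "Suc q = 2 * M" by (metis even_Suc evenE)
      \<comment> \<open>Halving gives a translation with factor \<open>1\<close>, but any such
        factor is \<open>-1\<close>; hence odd \<open>r > 1\<close> is impossible.\<close>
      have "thue_morse (M + j) = 1 * thue_morse j" if "j < M" for j
        using shift[of "2 * j"] that M thue_morse_even[of "M + j"] by simp
      then show ?thesis
        using thue_morse_translate[of M 1] M by auto
    qed
  qed
qed

subsection \<open>Roots of \<open>1 - z\<^sup>r + z\<^bsup>r+1\<^esup> - z\<^sup>m\<close>\<close>

lemma summable_norm_power_series:
  fixes z :: complex and a :: "nat \<Rightarrow> complex"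
  assumes "\<And>n. norm (a n) \<le> 1" "norm z < 1"
  shows "summable (\<lambda>n. norm (a n * z ^ n))"
proof (rule summable_comparison_test')
  show "summable (\<lambda>n. norm z ^ n)"
    using assms by (intro summable_geometric) simp
  show "norm (norm (a n * z ^ n)) \<le> norm z ^ n" if "n \<ge> 0" for n
    using mult_right_mono[OF assms(1)[of n], of "norm z ^ n"] by (simp add: norm_mult norm_power)
qed

text \<open>A zero \<open>z\<close> of \<open>F\<close> would give \<open>D(z\<^sup>2) = 0\<close>, hence \<open>D(z\<^sup>4) = 0\<close>, \<open>D(z\<^sup>8) = 0\<close> and so on, and these
  zeros would force \<open>D(0) = 0\<close>.\<close>

lemma doubling_nonzero:
  fixes z :: complex
  assumes dbl: "doubling U d" and d: "d 0 \<noteq> 0" "\<And>n. \<bar>d n\<bar> \<le> 1" and z: "norm z < 1"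
  shows "(\<Sum>n. of_bool (n \<in> U) * z ^ n) \<noteq> 0"
proof
  assume F0: "(\<Sum>n. of_bool (n \<in> U) * z ^ n) = 0"
  define D F where "D w = (\<Sum>n. of_int (d n) * w ^ n)" and "F w = (\<Sum>n. of_bool (n \<in> U) * w ^ n)"
    for w :: complex
  have abs_d: "norm (of_int (d n) :: complex) \<le> 1" for n
    using d(2)[of n] by (metis norm_of_int of_int_1 of_int_abs of_int_le_iff)
  have sumD: "summable (\<lambda>n. norm (of_int (d n) * w ^ n))" if "norm w < 1" for w :: complex
    by (rule summable_norm_power_series) (use that abs_d in auto)
  have sumF: "summable (\<lambda>n. norm (of_bool (n \<in> U) * w ^ n))" if "norm w < 1" for w :: complex
    by (rule summable_norm_power_series) (use that in auto)
  have norm_sq: "norm (w ^ 2) < 1" if "norm w < 1" for w :: complex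
    using that by (simp add: norm_power power_less_one_iff)
  have mult: "D w * F w = D (w ^ 2)" if w: "norm w < 1" for w
  proof -
    have "(\<lambda>n. \<Sum>i\<le>n. (of_int (d i) * w ^ i) * (of_bool (n - i \<in> U) * w ^ (n - i))) sums (D w * F w)"
      unfolding D_def F_def by (intro Cauchy_product_sums sumD sumF w)
    moreover have "(\<Sum>i\<le>n. (of_int (d i) * w ^ i) * (of_bool (n - i \<in> U) * w ^ (n - i)))
        = (if even n then of_int (d (n div 2)) * w ^ n else 0)" for n
    proof -
      have "(\<Sum>i\<le>n. (of_int (d i) * w ^ i) * (of_bool (n - i \<in> U) * w ^ (n - i)))
          = (\<Sum>i\<le>n. of_int (of_bool (n - i \<in> U) * d i) * w ^ n)"
        by (intro sum.cong refl) (auto simp flip: power_add)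
      also have "\<dots> = of_int (\<Sum>i\<le>n. of_bool (n - i \<in> U) * d i) * w ^ n"
        by (simp only: sum_distrib_right of_int_sum)
      also have "(\<Sum>i\<le>n. of_bool (n - i \<in> U) * d i) = (if even n then d (n div 2) else 0)"
        using dbl unfolding doubling_def by blast
      finally show ?thesis by simp
    qed
    ultimately have 1: "(\<lambda>n. if even n then of_int (d (n div 2)) * w ^ n else 0) sums (D w * F w)"
      by (simp only:)
    have "(\<lambda>n. of_int (d n) * (w ^ 2) ^ n) sums D (w ^ 2)"
      unfolding D_def by (rule summable_sums[OF summable_norm_cancel[OF sumD[OF norm_sq[OF w]]]])
    then have "(\<lambda>n. (\<lambda>k. if even k then of_int (d (k div 2)) * w ^ k else 0) (2 * n)) sums D (w ^ 2)"
      by (simp add: power_mult)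
    then have "(\<lambda>n. if even n then of_int (d (n div 2)) * w ^ n else 0) sums D (w ^ 2)"
      by (subst (asm) sums_mono_reindex) (auto simp: strict_mono_def elim!: evenE)
    with 1 show ?thesis
      by (rule sums_unique2)
  qed
  \<comment> \<open>\<open>mult\<close> passes a zero of \<open>D\<close> from \<open>w\<close> to
    \<open>w\<^sup>2\<close>; the exponents start at \<open>2 ^ 1\<close> since at \<open>z\<close>
    itself only \<open>F z = 0\<close> is known.\<close>
  have zero: "D (z ^ 2 ^ Suc k) = 0 \<and> norm (z ^ 2 ^ Suc k) < 1" for k
  proof (induction k)
    case 0
    then show ?case using mult[OF z] F0 norm_sq[OF z] by (simp add: F_def)
  next
    case (Suc k)
    then show ?case using mult[of "z ^ 2 ^ Suc k"] norm_sq[of "z ^ 2 ^ Suc k"]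
      by (simp add: mult.commute flip: power_mult)
  qed
  have "isCont D 0"
    unfolding D_def
    by (rule isCont_powser[where K = "1/2"]) (auto intro!: summable_norm_cancel[OF sumD])
  moreover have "(\<lambda>k. z ^ 2 ^ Suc k) \<longlonglongrightarrow> 0"
  proof -
    have "strict_mono (\<lambda>k. 2 ^ Suc k :: nat)"
      by (auto simp: strict_mono_def)
    from LIMSEQ_subseq_LIMSEQ[OF LIMSEQ_power_zero[OF z] this] show ?thesis
      by (simp add: o_def)
  qed
  ultimately have "(\<lambda>k. D (z ^ 2 ^ Suc k)) \<longlonglongrightarrow> D 0"
    by (rule isCont_tendsto_compose)
  then have "D 0 = 0"
    using zero by (simp add: LIMSEQ_const_iff)
  moreover have "D 0 = of_int (d 0)"
    unfolding D_def by (subst suminf_finite[of "{0}"]) auto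
  ultimately show False
    using d by simp
qed

text \<open>The series is \<open>1 / (1 - z)\<close> minus
  \<open>z\<^sup>r / (1 - z\<^sup>m)\<close>; clearing denominators lets zeros of a polynomial in
  the disc be read as zeros of the series.\<close>

lemma progression_complement_power_series:
  fixes z :: complex and m r :: nat
  assumes z: "norm z < 1" and m: "0 < m"
  shows "(1 - z) * (1 - z ^ m) * (\<Sum>n. of_bool (n \<in> - {r + m * k | k. True}) * z ^ n)
    = 1 - z ^ r + z ^ Suc r - z ^ m"
proof -
  have zm: "norm (z ^ m) < 1"
    using z m by (simp add: norm_power power_less_one_iff)
  have "(\<lambda>k. z ^ r * (z ^ m) ^ k) sums (z ^ r * (1 / (1 - z ^ m)))"
    by (intro sums_mult geometric_sums zm)
  then have "(\<lambda>k. (\<lambda>n. of_bool (n \<in> {r + m * k | k. True}) * z ^ n) (r + m * k))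
      sums (z ^ r * (1 / (1 - z ^ m)))"
    by (auto simp: power_add power_mult)
  then have "(\<lambda>n. of_bool (n \<in> {r + m * k | k. True}) * z ^ n) sums (z ^ r * (1 / (1 - z ^ m)))"
    by (subst (asm) sums_mono_reindex) (use m in \<open>auto simp: strict_mono_def\<close>)
  from sums_diff[OF geometric_sums[OF z] this]
  have "(\<lambda>n. of_bool (n \<in> - {r + m * k | k. True}) * z ^ n)
      sums (1 / (1 - z) - z ^ r * (1 / (1 - z ^ m)))"
    by (rule sums_cong[THEN iffD1, rotated]) auto
  moreover have "(1 - z) * (1 - z ^ m) * (1 / (1 - z) - z ^ r * (1 / (1 - z ^ m)))
      = (1 - z ^ m) - z ^ r * (1 - z)"
  proof -
    have "a * b * (1 / a - t * (1 / b)) = b - t * a" if "a \<noteq> 0" "b \<noteq> 0" for a b t :: complex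
      using that by (simp add: field_simps)
    moreover have "1 - z \<noteq> 0" "1 - z ^ m \<noteq> 0"
      using z zm by auto
    ultimately show ?thesis
      by blast
  qed
  ultimately show ?thesis
    by (simp add: sums_unique[symmetric] algebra_simps)
qed

text \<open>Once \<open>a\<close> is split off, the remaining product has norm at least
  \<open>1\<close>, so \<open>norm a \<le> 1\<close>.\<close>

lemma norm_prod_mset_eq_one_imp:
  fixes M :: "complex multiset"
  assumes "\<And>a. a \<in># M \<Longrightarrow> 1 \<le> norm a" "norm (prod_mset M) = 1" "a \<in># M"
  shows "norm a = 1"
proof -
  have ge: "1 \<le> norm (prod_mset N)" if "\<And>a. a \<in># N \<Longrightarrow> 1 \<le> norm a" for N :: "complex multiset"
    using that
  proof (induction N)
    case (add x N)
    then have "1 * 1 \<le> norm x * norm (prod_mset N)"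
      by (intro mult_mono) auto
    then show ?case by (simp add: norm_mult)
  qed simp
  obtain N where N: "M = add_mset a N"
    using assms(3) by (meson multi_member_split)
  have "1 \<le> norm (prod_mset N)" and a: "1 \<le> norm a"
    using assms(1) N by (auto intro!: ge)
  then have "norm a * 1 \<le> norm a * norm (prod_mset N)"
    by (intro mult_left_mono) auto
  with a assms(2) show ?thesis
    by (simp add: N norm_mult)
qed

text \<open>By Vieta all roots lie on the unit circle, so \<open>a \<mapsto> 1 / a\<close> permutes them as \<open>a \<mapsto> cnj a\<close> does.\<close>

lemma reflect_poly_eq_smult_cnj:
  fixes p :: "complex poly"
  assumes roots: "\<And>z. poly p z = 0 \<Longrightarrow> 1 \<le> norm z"
    and coeffs: "norm (coeff p 0) = norm (lead_coeff p)" and "p \<noteq> 0"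
  shows "\<exists>c. reflect_poly p = smult c (map_poly cnj p)"
proof -
  define M where "M = proots p"
  have p: "p = smult (lead_coeff p) (\<Prod>a\<in>#M. [:-a, 1:])"
    unfolding M_def by (rule complex_poly_decompose_multiset[symmetric])
  have M: "1 \<le> norm a" if "a \<in># M" for a
    using that roots \<open>p \<noteq> 0\<close> by (simp add: M_def)
  have "norm (coeff (\<Prod>a\<in>#N. [:-a, 1:]) 0) = norm (prod_mset N)" for N :: "complex multiset"
    by (induction N) (auto simp: coeff_mult_0 norm_mult)
  then have "norm (prod_mset M) = 1"
    using coeffs \<open>p \<noteq> 0\<close> arg_cong[OF p, of "\<lambda>p. norm (coeff p 0)"] by (simp add: norm_mult)
  then have unit: "norm a = 1" if "a \<in># M" for a
    using norm_prod_mset_eq_one_imp[OF M] that by blast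
  have cnj_mult: "map_poly cnj (q * s) = map_poly cnj q * map_poly cnj s" for q s
    by (rule poly_eqI) (simp add: coeff_map_poly coeff_mult)
  have "\<exists>c. reflect_poly (\<Prod>a\<in>#N. [:-a, 1:]) = smult c (map_poly cnj (\<Prod>a\<in>#N. [:-a, 1:]))"
    if "\<And>a. a \<in># N \<Longrightarrow> norm a = 1" for N
    using that
  proof (induction N)
    case empty
    show ?case by (intro exI[of _ 1]) (simp add: map_poly_1)
  next
    case (add x N)
    then obtain c where c: "reflect_poly (\<Prod>a\<in>#N. [:-a, 1:])
        = smult c (map_poly cnj (\<Prod>a\<in>#N. [:-a, 1:]))"
      by auto
    have "x * cnj x = 1"
      using add.prems[of x] by (simp add: complex_norm_square[symmetric])
    moreover have "x \<noteq> 0"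
      using add.prems[of x] by auto
    \<comment> \<open>For \<open>norm x = 1\<close>, \<open>1 - x z = -x (z - cnj x)\<close>; a
      nonzero \<open>x\<close> ensures that reflection keeps the degree.\<close>
    ultimately have "reflect_poly [:-x, 1:] = smult (-x) (map_poly cnj [:-x, 1:])"
      by (simp add: reflect_poly_pCons map_poly_pCons)
    then show ?case
      by (intro exI[of _ "c * -x"])
        (simp only: image_mset_add_mset prod_mset.add_mset reflect_poly_mult cnj_mult c
          mult_smult_left mult_smult_right smult_smult)
  qed
  with unit obtain c where c: "reflect_poly (\<Prod>a\<in>#M. [:-a, 1:])
      = smult c (map_poly cnj (\<Prod>a\<in>#M. [:-a, 1:]))"
    by blast
  define b where "b = lead_coeff p"
  have "b \<noteq> 0"
    using \<open>p \<noteq> 0\<close> by (simp add: b_def)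
  have "map_poly cnj p = smult (cnj b) (map_poly cnj (\<Prod>a\<in>#M. [:-a, 1:]))"
    by (subst p, fold b_def) (rule poly_eqI, simp add: coeff_map_poly)
  moreover have "reflect_poly p = smult b (smult c (map_poly cnj (\<Prod>a\<in>#M. [:-a, 1:])))"
    by (subst p, fold b_def) (simp add: reflect_poly_smult c)
  ultimately show ?thesis
    using \<open>b \<noteq> 0\<close> by (intro exI[of _ "b * c / cnj b"]) simp
qed

lemma doubling_progression_parameters:
  fixes m r :: nat
  assumes dbl: "doubling (- {r + m * k | k. True}) d"
    and d: "d 0 \<noteq> 0" "\<And>n. \<bar>d n\<bar> \<le> 1" and m: "2 \<le> m" and r: "0 < r"
  shows "m = Suc r \<or> m = Suc (2 * r)"
proof (cases "m = Suc r")
  case False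
  define p :: "complex poly" where "p = 1 - monom 1 r + monom 1 (Suc r) - monom 1 m"
  have coeff_p: "coeff p n = of_bool (n = 0) - of_bool (n = r) + of_bool (n = Suc r) - of_bool (n = m)"
    for n
    by (auto simp: p_def)
  have coeff_p_0: "coeff p 0 = 1"
    using m r by (simp add: coeff_p)
  have degree_p: "degree p = max m (Suc r)"
  proof (rule antisym)
    show "degree p \<le> max m (Suc r)"
      using m by (intro degree_le) (auto simp: coeff_p)
    show "max m (Suc r) \<le> degree p"
      using m False by (intro le_degree) (auto simp: coeff_p max_def)
  qed
  have lead: "lead_coeff p = (if r < m then -1 else 1)"
    using m False unfolding degree_p by (auto simp: coeff_p max_def)
  have "1 \<le> norm z" if "poly p z = 0" for z
  proof (rule ccontr)
    assume "\<not> 1 \<le> norm z"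
    then have z: "norm z < 1" by simp
    moreover have "poly p z = 1 - z ^ r + z ^ Suc r - z ^ m"
      by (simp add: p_def poly_monom)
    ultimately have "(1 - z) * (1 - z ^ m)
        * (\<Sum>n. of_bool (n \<in> - {r + m * k | k. True}) * z ^ n) = 0"
      using progression_complement_power_series[OF z, of m r] m that by simp
    moreover have "1 - z \<noteq> 0" "1 - z ^ m \<noteq> 0"
      using z m power_less_one_iff[of "norm z" m] by (auto simp flip: norm_power)
    ultimately show False
      using doubling_nonzero[OF dbl d z] by simp
  qed
  moreover have "norm (coeff p 0) = norm (lead_coeff p)"
    using lead coeff_p_0 by simp
  moreover have "p \<noteq> 0"
    using coeff_p_0 by auto
  ultimately obtain c where c: "reflect_poly p = smult c (map_poly cnj p)"
    using reflect_poly_eq_smult_cnj by blast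
  have self: "coeff p (degree p - n) = c * coeff p n" if "n \<le> degree p" for n
    using arg_cong[OF c, of "\<lambda>p. coeff p n"] that
    by (simp add: coeff_reflect_poly coeff_map_poly coeff_p)
  have c_lead: "c = (if r < m then -1 else 1)"
    using self[of 0] lead coeff_p_0 by simp
  show ?thesis
  proof (cases "r < m")
    case True
    \<comment> \<open>The coefficient at \<open>r\<close> is \<open>-1\<close>, so the one at
      \<open>m - r\<close> is \<open>1\<close>; as \<open>m - r > 0\<close>, this means
      \<open>m - r = Suc r\<close>.\<close>
    then have "coeff p r = - coeff p (m - r)"
      using self[of "m - r"] c_lead False by (simp add: degree_p max_def)
    then show ?thesis
      using True r m False by (auto simp: coeff_p of_bool_def split: if_splits)
  next
    case False
    \<comment> \<open>Contradictory: the coefficient at \<open>1\<close> is \<open>0\<close> because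
      \<open>r \<ge> m \<ge> 2\<close>, while that at \<open>r\<close> is negative.\<close>
    then have "coeff p r = coeff p 1"
      using self[of 1] c_lead by (simp add: degree_p max_def)
    then show ?thesis
      using False r m by (auto simp: coeff_p of_bool_def split: if_splits)
  qed
qed simp

subsection \<open>Subset sums\<close>

text \<open>Ordered pairs suit the exchange argument below, which need not respect
  \<open>s < s'\<close>.\<close>

lemma rep_count_eq_if_card_eq:
  assumes "\<And>n. card {(s, s'). s \<in> S \<and> s' \<in> S \<and> s \<noteq> s' \<and> s + s' = n}
             = card {(s, s'). s \<in> T \<and> s' \<in> T \<and> s \<noteq> s' \<and> s + s' = n}"
  shows "rep_count S n = rep_count T n"
proof -
  have two: "2 * rep_count S n = card {(s, s'). s \<in> S \<and> s' \<in> S \<and> s \<noteq> s' \<and> s + s' = n}" for S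
  proof -
    have "bij_betw (\<lambda>i. (i, n - i)) {i. i \<le> n \<and> i \<in> S \<and> n - i \<in> S \<and> 2 * i \<noteq> n}
        {(s, s'). s \<in> S \<and> s' \<in> S \<and> s \<noteq> s' \<and> s + s' = n}"
      by (rule bij_betw_byWitness[where f' = fst]) auto
    then show ?thesis
      unfolding two_rep_count by (rule bij_betw_same_card)
  qed
  show ?thesis
    using two[of S] two[of T] assms[of n] by linarith
qed

text \<open>Exchanging the least index on which \<open>I\<close> and \<open>J\<close> differ preserves the sum of the two subset sums
  and flips the parity of both cardinalities.\<close>

lemma rep_count_H0_eq_H1:
  assumes inj: "inj_on (sum h) {I. finite I \<and> I \<subseteq> {1..}}"
  shows "rep_count (H0 h) n = rep_count (H1 h) n"
proof (rule rep_count_eq_if_card_eq)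
  fix n
  \<comment> \<open>Pairs of index sets stand for pairs of sums; by injectivity
    \<open>I \<noteq> J\<close> corresponds to \<open>s \<noteq> s'\<close>.\<close>
  define P where "P b = {(I, J). finite I \<and> I \<subseteq> {1..} \<and> finite J \<and> J \<subseteq> {1..} \<and> I \<noteq> J \<and>
    sum h I + sum h J = n \<and> even (card I) = b \<and> even (card J) = b}" for b
  define \<Delta> where "\<Delta> I J = I - J \<union> (J - I)" for I J :: "nat set"
  define swap where "swap = (\<lambda>(I, J). (\<Delta> I {Min (\<Delta> I J)}, \<Delta> J {Min (\<Delta> I J)}))"
  have pairs: "bij_betw (\<lambda>(I, J). (sum h I, sum h J)) (P b)
     {(s, s'). s \<in> S \<and> s' \<in> S \<and> s \<noteq> s' \<and> s + s' = n}"
    if S: "S = {sum h I | I. finite I \<and> I \<subseteq> {1..} \<and> even (card I) = b}" for S b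
    unfolding bij_betw_def
  proof
    show "inj_on (\<lambda>(I, J). (sum h I, sum h J)) (P b)"
      using inj by (auto simp: inj_on_def P_def)
    show "(\<lambda>(I, J). (sum h I, sum h J)) ` P b
        = {(s, s'). s \<in> S \<and> s' \<in> S \<and> s \<noteq> s' \<and> s + s' = n}"
      using inj_onD[OF inj] by (auto simp: P_def S image_iff)
  qed
  have swap_in: "swap (I, J) \<in> P (\<not> b) \<and> swap (swap (I, J)) = (I, J)" if IJ: "(I, J) \<in> P b" for I J b
  proof -
    define x where "x = Min (\<Delta> I J)"
    have IJ': "finite I" "I \<subseteq> {1..}" "finite J" "J \<subseteq> {1..}" "I \<noteq> J"
      "sum h I + sum h J = n" "even (card I) = b" "even (card J) = b"
      using IJ by (auto simp: P_def)
    have "finite (\<Delta> I J)" "\<Delta> I J \<noteq> {}"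
      using IJ' by (auto simp: \<Delta>_def)
    then have x: "x \<in> \<Delta> I J"
      unfolding x_def by (rule Min_in)
    have swap: "swap (I, J) = (\<Delta> I {x}, \<Delta> J {x})"
      by (simp add: swap_def x_def)
    \<comment> \<open>Toggling \<open>x\<close> in both sets leaves their symmetric difference
      unchanged, so a second \<open>swap\<close> picks the same \<open>x\<close>.\<close>
    have "\<Delta> (\<Delta> I {x}) (\<Delta> J {x}) = \<Delta> I J" "\<Delta> (\<Delta> I {x}) {x} = I" "\<Delta> (\<Delta> J {x}) {x} = J"
      by (auto simp: \<Delta>_def)
    then have inv: "swap (swap (I, J)) = (I, J)"
      unfolding swap by (simp add: swap_def x_def[symmetric])
    have parity: "even (card (\<Delta> K {x})) \<longleftrightarrow> odd (card K)" if "finite K" for K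
    proof (cases "x \<in> K")
      case True
      then have "\<Delta> K {x} = K - {x}" "card K > 0"
        using that by (auto simp: \<Delta>_def card_gt_0_iff)
      then show ?thesis using True that by (auto simp: card_Diff_singleton)
    next
      case False
      then have "\<Delta> K {x} = insert x K" by (auto simp: \<Delta>_def)
      then show ?thesis using False that by simp
    qed
    have add: "sum h (\<Delta> K {x}) = sum h K + h x" if "finite K" "x \<notin> K" for K
    proof -
      have "\<Delta> K {x} = insert x K" using that by (auto simp: \<Delta>_def)
      with that show ?thesis by simp
    qed
    have del: "sum h (\<Delta> K {x}) + h x = sum h K" if "finite K" "x \<in> K" for K
    proof -
      have "\<Delta> K {x} = K - {x}" using that by (auto simp: \<Delta>_def)
      with that show ?thesis by (simp add: sum.remove[of K x h])
    qed
    \<comment> \<open>\<open>x\<close> lies in exactly one of the two sets, so \<open>h x\<close>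
      moves from one sum to the other.\<close>
    have "sum h (\<Delta> I {x}) + sum h (\<Delta> J {x}) = n"
      using x add[of I] add[of J] del[of I] del[of J] IJ' unfolding \<Delta>_def[of I J] by auto
    moreover have "\<Delta> I {x} \<noteq> \<Delta> J {x}"
      using IJ'(5) \<open>\<Delta> (\<Delta> I {x}) {x} = I\<close> \<open>\<Delta> (\<Delta> J {x}) {x} = J\<close> by metis
    moreover have "finite (\<Delta> I {x})" "finite (\<Delta> J {x})" "\<Delta> I {x} \<subseteq> {1..}" "\<Delta> J {x} \<subseteq> {1..}"
      using IJ' x by (auto simp: \<Delta>_def)
    ultimately show ?thesis
      using inv parity IJ' unfolding swap by (auto simp: P_def)
  qed
  have "bij_betw swap (P True) (P False)"
    by (rule bij_betw_byWitness[where f' = swap]) (use swap_in in \<open>fastforce+\<close>)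
  then have "card (P True) = card (P False)"
    by (rule bij_betw_same_card)
  then show "card {(s, s'). s \<in> H0 h \<and> s' \<in> H0 h \<and> s \<noteq> s' \<and> s + s' = n}
      = card {(s, s'). s \<in> H1 h \<and> s' \<in> H1 h \<and> s \<noteq> s' \<and> s + s' = n}"
    using bij_betw_same_card[OF pairs[of "H0 h" True]] bij_betw_same_card[OF pairs[of "H1 h" False]]
    by (simp add: H0_def H1_def)
qed

lemma H0_Int_H1:
  assumes inj: "inj_on (sum h) {I. finite I \<and> I \<subseteq> {1..}}"
  shows "H0 h \<inter> H1 h = {}"
  using inj_onD[OF inj] by (fastforce simp: H0_def H1_def)

lemma H0_Un_H1: "H0 h \<union> H1 h = sum h ` {I. finite I \<and> I \<subseteq> {1..}}"
  by (auto simp: H0_def H1_def)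

section \<open>Subset sums as unions of residue classes\<close>

lemma set_encode_less:
  assumes "X \<subseteq> {..<l}"
  shows "set_encode X < 2 ^ l"
proof -
  have "set_encode X \<le> (\<Sum>i<l. 2 ^ i)"
    unfolding set_encode_def using assms by (intro sum_mono2) auto
  also have "\<dots> < 2 ^ l"
    by (induction l) auto
  finally show ?thesis .
qed

lemma set_decode_subset_lessThan:
  assumes "u < 2 ^ l"
  shows "set_decode u \<subseteq> {..<l}"
proof
  fix x
  assume "x \<in> set_decode u"
  then have "2 ^ x \<le> u"
    by (auto simp: set_decode_def intro: ccontr)
  from this assms have "(2::nat) ^ x < 2 ^ l"
    by (rule le_less_trans)
  then show "x \<in> {..<l}"
    by simp
qed

text \<open>The first \<open>l\<close> terms encode a number \<open>u < 2 ^ l\<close> with sum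
  \<open>g u\<close>, and the later terms form an arbitrary multiple of \<open>M\<close>. Uniqueness
  of division by \<open>M\<close> and of binary expansions gives both claims.\<close>

lemma subset_sums_two_scales:
  fixes h g :: "nat \<Rightarrow> nat"
  assumes low: "\<And>X. X \<subseteq> {..<l} \<Longrightarrow> (\<Sum>i\<in>X. h (Suc i)) = g (set_encode X)"
    and high: "\<And>j. h (Suc (l + j)) = M * 2 ^ j"
    and g: "inj_on g {..<2 ^ l}" "g ` {..<2 ^ l} \<subseteq> {..<M}"
  shows "inj_on (sum h) {I. finite I \<and> I \<subseteq> {1..}}"
    and "sum h ` {I. finite I \<and> I \<subseteq> {1..}} = {n. n mod M \<in> g ` {..<2 ^ l}}"
proof -
  define X Y where "X I = {i. i < l \<and> Suc i \<in> I}" and "Y I = {j. Suc (l + j) \<in> I}" for I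
  have split: "I = Suc ` X I \<union> (\<lambda>j. Suc (l + j)) ` Y I" if "I \<subseteq> {1..}" for I
  proof
    show "I \<subseteq> Suc ` X I \<union> (\<lambda>j. Suc (l + j)) ` Y I"
    proof
      fix i
      assume "i \<in> I"
      with that have "i = Suc (i - 1)"
        by auto
      with \<open>i \<in> I\<close> consider "i - 1 \<in> X I" | "i - 1 - l \<in> Y I" "i = Suc (l + (i - 1 - l))"
        by (fastforce simp: X_def Y_def)
      with \<open>i = Suc (i - 1)\<close> show "i \<in> Suc ` X I \<union> (\<lambda>j. Suc (l + j)) ` Y I"
        by cases blast+
    qed
  qed (auto simp: X_def Y_def)
  have X: "X I \<subseteq> {..<l}" for I
    by (auto simp: X_def)
  have finX: "finite (X I)" for I
    by (rule finite_subset[OF X]) simp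
  have finY: "finite (Y I)" if "finite I" for I
    unfolding Y_def using finite_vimageI[OF that, of "\<lambda>j. Suc (l + j)"] by (simp add: inj_def vimage_def)
  have sum: "sum h I = g (set_encode (X I)) + M * set_encode (Y I)" if "finite I" "I \<subseteq> {1..}" for I
  proof -
    have "sum h I = sum h (Suc ` X I) + sum h ((\<lambda>j. Suc (l + j)) ` Y I)"
      by (subst split[OF that(2)], rule sum.union_disjoint)
        (use finX finY that in \<open>auto simp: X_def\<close>)
    also have "sum h (Suc ` X I) = g (set_encode (X I))"
      by (simp add: sum.reindex low X)
    also have "sum h ((\<lambda>j. Suc (l + j)) ` Y I) = M * set_encode (Y I)"
      by (simp add: sum.reindex inj_on_def high set_encode_def sum_distrib_left)
    finally show ?thesis .
  qed
  have less: "g (set_encode (X I)) < M" for I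
    using g(2) set_encode_less[OF X] by blast
  show "inj_on (sum h) {I. finite I \<and> I \<subseteq> {1..}}"
  proof (rule inj_onI, clarify)
    fix I J
    assume IJ: "finite I" "I \<subseteq> {1..}" "finite J" "J \<subseteq> {1..}" and "sum h I = sum h J"
    then have eq: "g (set_encode (X I)) + M * set_encode (Y I) = g (set_encode (X J)) + M * set_encode (Y J)"
      by (simp add: sum)
    have "g (set_encode (X I)) = g (set_encode (X J))"
      using arg_cong[OF eq, of "\<lambda>n. n mod M"] by (simp add: less)
    then have "X I = X J"
      using inj_onD[OF g(1)] set_encode_less[OF X] finX set_encode_eq by (metis lessThan_iff)
    moreover have "Y I = Y J"
      using arg_cong[OF eq, of "\<lambda>n. n div M"] less[of I] less[of J] finY IJ set_encode_eq by auto
    ultimately show "I = J"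
      using split IJ by metis
  qed
  show "sum h ` {I. finite I \<and> I \<subseteq> {1..}} = {n. n mod M \<in> g ` {..<2 ^ l}}"
  proof (intro equalityI subsetI)
    fix n
    assume "n \<in> sum h ` {I. finite I \<and> I \<subseteq> {1..}}"
    then obtain I where "n = g (set_encode (X I)) + M * set_encode (Y I)"
      by (auto simp: sum)
    then show "n \<in> {n. n mod M \<in> g ` {..<2 ^ l}}"
      using less[of I] set_encode_less[OF X, of I] by auto
  next
    fix n
    assume "n \<in> {n. n mod M \<in> g ` {..<2 ^ l}}"
    then obtain u where u: "u < 2 ^ l" "n mod M = g u"
      by auto
    define I where "I = Suc ` set_decode u \<union> (\<lambda>j. Suc (l + j)) ` set_decode (n div M)"
    have "X I = set_decode u" "Y I = set_decode (n div M)"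
      using set_decode_subset_lessThan[OF u(1)] by (auto simp: X_def Y_def I_def)
    moreover have I: "finite I" "I \<subseteq> {1..}"
      by (auto simp: I_def)
    ultimately have "sum h I = n"
      using mod_mult_div_eq[of n M] u by (simp add: sum)
    with I show "n \<in> sum h ` {I. finite I \<and> I \<subseteq> {1..}}"
      by auto
  qed
qed

lemma residue_class_eq:
  fixes c M :: nat
  assumes "c < M"
  shows "{n. n mod M = c} = {c + M * k | k. True}"
proof -
  have "\<exists>k. n = n mod M + M * k" for n
    by (rule exI[of _ "n div M"]) simp
  with assms show ?thesis
    by auto
qed

text \<open>Here \<open>g\<close> is the identity and the modulus is \<open>2 ^ l + 1\<close>, so
  exactly the residue \<open>2 ^ l\<close> is not attained.\<close>

lemma inj_on_subset_sums_seq1: "inj_on (sum (seq1 l)) {I. finite I \<and> I \<subseteq> {1..}}" (is ?inj)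
  and S1_Un_T1: "S1 l \<union> T1 l = - {2 ^ l + (2 ^ l + 1) * k | k. True}" (is ?Un)
proof -
  let ?M = "2 ^ l + 1 :: nat"
  have low: "(\<Sum>i\<in>X. seq1 l (Suc i)) = id (set_encode X)" if "X \<subseteq> {..<l}" for X
    using that by (auto simp: seq1_def set_encode_def intro!: sum.cong)
  have high: "seq1 l (Suc (l + j)) = ?M * 2 ^ j" for j
    by (simp add: seq1_def)
  note two_scales = subset_sums_two_scales[OF low high]
  show ?inj
    by (rule two_scales) auto
  have "S1 l \<union> T1 l = {n. n mod ?M \<in> id ` {..<2 ^ l}}"
    unfolding S1_def T1_def H0_Un_H1 by (rule two_scales) auto
  also have "\<dots> = - {n. n mod ?M = 2 ^ l}"
    using mod_less_divisor[of ?M] by (auto simp: less_Suc_eq)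
  also have "{n. n mod ?M = 2 ^ l} = {2 ^ l + ?M * k | k. True}"
    by (rule residue_class_eq) simp
  finally show ?Un .
qed

text \<open>The last low term exceeds a power of two by \<open>1\<close>, so codes from
  \<open>2 ^ l\<close> on are raised by one and the residue \<open>2 ^ l\<close> is skipped.\<close>

lemma inj_on_subset_sums_seq2: "inj_on (sum (seq2 (Suc l))) {I. finite I \<and> I \<subseteq> {1..}}" (is ?inj)
  and S2_Un_T2: "S2 (Suc l) \<union> T2 (Suc l) = - {2 ^ l + (2 * 2 ^ l + 1) * k | k. True}" (is ?Un)
proof -
  let ?M = "2 * 2 ^ l + 1 :: nat"
  define g where "g u = u + of_bool (2 ^ l \<le> u)" for u :: nat
  have low: "(\<Sum>i\<in>X. seq2 (Suc l) (Suc i)) = g (set_encode X)" if X: "X \<subseteq> {..<Suc l}" for X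
  proof -
    have finX: "finite X"
      using X by (rule finite_subset) simp
    have "2 ^ l \<le> set_encode X \<longleftrightarrow> l \<in> X"
    proof
      assume "2 ^ l \<le> set_encode X"
      then show "l \<in> X"
        using set_encode_less[of X l] X by (force simp: less_Suc_eq)
    next
      assume "l \<in> X"
      then show "2 ^ l \<le> set_encode X"
        unfolding set_encode_def using finX by (intro member_le_sum) auto
    qed
    moreover have "(\<Sum>i\<in>X. seq2 (Suc l) (Suc i)) = (\<Sum>i\<in>X. 2 ^ i + (if i = l then 1 else 0))"
      using X by (intro sum.cong) (auto simp: seq2_def)
    ultimately show ?thesis
      using finX by (simp add: sum.distrib set_encode_def g_def)
  qed
  have high: "seq2 (Suc l) (Suc (Suc l + j)) = ?M * 2 ^ j" for j
    by (simp add: seq2_def)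
  note two_scales = subset_sums_two_scales[OF low high]
  have inj: "inj_on g {..<2 ^ Suc l}" and sub: "g ` {..<2 ^ Suc l} \<subseteq> {..<?M}"
    by (auto simp: inj_on_def g_def of_bool_def split: if_splits)
  show ?inj
    by (rule two_scales) (assumption | fact inj sub)+
  have img: "g ` {..<2 ^ Suc l} = {..<?M} - {2 ^ l}"
  proof (intro equalityI subsetI)
    fix x
    assume x: "x \<in> {..<?M} - {2 ^ l}"
    show "x \<in> g ` {..<2 ^ Suc l}"
    proof (cases "x < 2 ^ l")
      case True
      then show ?thesis by (intro image_eqI[of _ _ x]) (auto simp: g_def)
    next
      case False
      with x show ?thesis by (intro image_eqI[of _ _ "x - 1"]) (auto simp: g_def)
    qed
  next
    fix x
    assume "x \<in> g ` {..<2 ^ Suc l}"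
    then show "x \<in> {..<?M} - {2 ^ l}"
      by (auto simp: g_def of_bool_def split: if_splits)
  qed
  have "S2 (Suc l) \<union> T2 (Suc l) = {n. n mod ?M \<in> g ` {..<2 ^ Suc l}}"
    unfolding S2_def T2_def H0_Un_H1 by (rule two_scales) (assumption | fact inj sub)+
  also have "\<dots> = - {n. n mod ?M = 2 ^ l}"
    unfolding img using mod_less_divisor[of ?M] by auto
  also have "{n. n mod ?M = 2 ^ l} = {2 ^ l + ?M * k | k. True}"
    by (rule residue_class_eq) simp
  finally show ?Un .
qed

lemma subset_sums_cong:
  assumes "\<And>i. 1 \<le> i \<Longrightarrow> h i = h' i"
  shows "H0 h = H0 h'" and "H1 h = H1 h'"
proof -
  have "sum h I = sum h' I" if "I \<subseteq> {1..}" for I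
    using that assms by (intro sum.cong) auto
  then show "H0 h = H0 h'" "H1 h = H1 h'"
    unfolding H0_def H1_def by (intro Collect_cong ex_cong1; auto)+
qed

text \<open>For \<open>l = 0\<close> the exceptional value of \<open>seq2\<close> sits at index
  \<open>0\<close>, which no index set contains.\<close>

lemma S2_0: "S2 0 = S1 0" and T2_0: "T2 0 = T1 0"
  unfolding S1_def T1_def S2_def T2_def
  by (rule subset_sums_cong, simp add: seq1_def seq2_def)+

lemma zero_in_H0: "0 \<in> H0 h"
  unfolding H0_def by (rule CollectI) (rule exI[of _ "{}"], simp)

section \<open>Representation counts of the listed pairs\<close>

lemma rep_count_S1_eq_T1: "rep_count (S1 l) n = rep_count (T1 l) n"
  unfolding S1_def T1_def by (rule rep_count_H0_eq_H1 inj_on_subset_sums_seq1)+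

lemma rep_count_S2_eq_T2: "rep_count (S2 l) n = rep_count (T2 l) n"
proof (cases l)
  case 0
  then show ?thesis
    by (simp add: S2_0 T2_0 rep_count_S1_eq_T1)
next
  case (Suc k)
  then show ?thesis
    unfolding S2_def T2_def using rep_count_H0_eq_H1[OF inj_on_subset_sums_seq2] by simp
qed

lemma rep_count_shift1:
  "rep_count (shift1 S) n = (if n < 2 then 0 else rep_count S (n - 2))"
proof (cases "n < 2")
  case True
  then have "{(s, s'). s \<in> shift1 S \<and> s' \<in> shift1 S \<and> s < s' \<and> n = s + s'} = {}"
    by (auto simp: shift1_def)
  with True show ?thesis
    unfolding rep_count_def by (simp only: card.empty if_True)
next
  case False
  have "bij_betw (\<lambda>(s, s'). (Suc s, Suc s')) {(s, s'). s \<in> S \<and> s' \<in> S \<and> s < s' \<and> n - 2 = s + s'}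
      {(s, s'). s \<in> shift1 S \<and> s' \<in> shift1 S \<and> s < s' \<and> n = s + s'}"
    using False by (intro bij_betw_byWitness[where f' = "\<lambda>(s, s'). (s - 1, s' - 1)"])
      (auto simp: shift1_def)
  with False show ?thesis
    unfolding rep_count_def by (simp add: bij_betw_same_card)
qed

lemma rep_count_eq_if_in_list:
  assumes "in_list A B"
  shows "rep_count A n = rep_count B n"
  using assms
  by (auto simp: in_list_def rep_count_S1_eq_T1 rep_count_S2_eq_T2 rep_count_shift1)

subsection \<open>Classification\<close>

text \<open>That \<open>0\<close> lies in \<open>A\<close> and \<open>A'\<close> fixes the sign of
  the solution; disjoint sets are recovered as the places where it is \<open>1\<close> and
  \<open>-1\<close>.\<close>

lemma rep_count_partition_unique:
  assumes un: "A \<union> B = A' \<union> B'" and disj: "A \<inter> B = {}" "A' \<inter> B' = {}"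
    and rep: "\<And>n. rep_count A n = rep_count B n" "\<And>n. rep_count A' n = rep_count B' n"
    and zero: "0 \<in> A" "0 \<in> A'"
  shows "A = A' \<and> B = B'"
proof -
  have "doubling (A \<union> B) (signed_ind A B)" "doubling (A \<union> B) (signed_ind A' B')"
    using rep_count_eq_iff_doubling[OF disj(1)] rep_count_eq_iff_doubling[OF disj(2)] rep un by auto
  moreover have "signed_ind A B 0 = signed_ind A' B' 0"
    using zero disj by (auto simp: signed_ind_def)
  ultimately have eq: "signed_ind A B = signed_ind A' B'"
    using doubling_unique[of "A \<union> B"] zero(1) by blast
  have "x \<in> C \<longleftrightarrow> signed_ind C D x = 1" "x \<in> D \<longleftrightarrow> signed_ind C D x = -1"
    if "C \<inter> D = {}" for x :: nat and C D
    using that by (auto simp: signed_ind_def of_bool_def)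
  with disj eq show ?thesis
    by (metis subsetI subset_antisym)
qed

text \<open>The conclusion records \<open>m\<close> in each case so that the translated problem,
  with \<open>r = m - 1\<close>, can discard the second one.\<close>

lemma rep_count_eq_imp_S_T:
  fixes m r :: nat
  assumes m: "2 \<le> m" and r: "0 < r"
    and un: "A \<union> B = - {r + m * k | k. True}" and disj: "A \<inter> B = {}"
    and rep: "\<And>n. rep_count A n = rep_count B n" and zero: "0 \<in> A"
  shows "m = Suc r \<and> (\<exists>l. A = S1 l \<and> B = T1 l) \<or> m = Suc (2 * r) \<and> (\<exists>l. A = S2 l \<and> B = T2 l)"
proof -
  define d where "d = signed_ind A B"
  have dbl: "doubling (- {r + m * k | k. True}) d"
    using rep_count_eq_iff_doubling[OF disj] rep un by (simp add: d_def)
  have "r \<notin> A \<union> B"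
    unfolding un by (auto intro: exI[of _ 0])
  then have d: "d 0 = 1" "d r = 0" "\<And>n. \<bar>d n\<bar> \<le> 1"
    using zero disj by (auto simp: d_def signed_ind_def)
  then have cases: "m = Suc r \<or> m = Suc (2 * r)"
    using m r by (intro doubling_progression_parameters[OF dbl]) auto
  then have "r < m"
    using r by auto
  with dbl r d obtain k where k: "r = 2 ^ k"
    using power_of_two_if_doubling by blast
  from cases show ?thesis
  proof
    assume "m = Suc r"
    moreover have "A = S1 k \<and> B = T1 k"
    proof (rule rep_count_partition_unique)
      show "A \<union> B = S1 k \<union> T1 k"
        using un \<open>m = Suc r\<close> k by (simp add: S1_Un_T1)
      show "S1 k \<inter> T1 k = {}"
        unfolding S1_def T1_def by (rule H0_Int_H1 inj_on_subset_sums_seq1)+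
      show "0 \<in> S1 k"
        unfolding S1_def by (rule zero_in_H0)
    qed (fact disj rep zero rep_count_S1_eq_T1)+
    ultimately show ?thesis
      by blast
  next
    assume "m = Suc (2 * r)"
    \<comment> \<open>In the second family the missing residue is \<open>2 ^ (l - 1)\<close>, hence
      \<open>l = Suc k\<close>.\<close>
    moreover have "A = S2 (Suc k) \<and> B = T2 (Suc k)"
    proof (rule rep_count_partition_unique)
      show "A \<union> B = S2 (Suc k) \<union> T2 (Suc k)"
        using un \<open>m = Suc (2 * r)\<close> k by (simp add: S2_Un_T2)
      show "S2 (Suc k) \<inter> T2 (Suc k) = {}"
        unfolding S2_def T2_def by (rule H0_Int_H1 inj_on_subset_sums_seq2)+
      show "0 \<in> S2 (Suc k)"
        unfolding S2_def by (rule zero_in_H0)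
    qed (fact disj rep zero rep_count_S2_eq_T2)+
    ultimately show ?thesis
      by blast
  qed
qed

text \<open>For \<open>r = 0\<close> the number \<open>0\<close> lies in neither set; translating
  down by one makes \<open>m - 1\<close> the missing residue and puts \<open>0\<close> into the
  union.\<close>

lemma in_list_if_rep_count_eq:
  fixes m r :: nat
  assumes m: "2 \<le> m" and un: "A \<union> B = - {r + m * k | k. True}" and disj: "A \<inter> B = {}"
    and rep: "\<And>n. rep_count A n = rep_count B n"
  shows "in_list A B \<or> in_list B A"
proof (cases "r = 0")
  case False
  then have "0 \<in> A \<union> B"
    unfolding un by auto
  moreover have "in_list A B" if "0 \<in> A"
    using rep_count_eq_imp_S_T[OF m _ un disj rep that] False unfolding in_list_def by blast
  moreover have "in_list B A" if "0 \<in> B"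
    using rep_count_eq_imp_S_T[of m r B A] that m un disj rep False unfolding in_list_def
    by (metis Int_commute Un_commute neq0_conv)
  ultimately show ?thesis
    by blast
next
  case True
  define A0 B0 where "A0 = Suc -` A" and "B0 = Suc -` B"
  have "0 \<notin> A \<union> B"
    unfolding un using True by (auto intro: exI[of _ 0])
  then have A: "A = shift1 A0" and B: "B = shift1 B0"
    by (auto simp: shift1_def A0_def B0_def) (metis not0_implies_Suc)+
  have rep0: "rep_count A0 n = rep_count B0 n" for n
    using rep[of "n + 2"] unfolding A B by (simp add: rep_count_shift1)
  have "(\<exists>k. Suc n = m * k) \<longleftrightarrow> (\<exists>k. n = (m - 1) + m * k)" for n
  proof
    assume "\<exists>k. Suc n = m * k"
    then obtain k where "Suc n = m * k" ..
    moreover from this obtain j where "k = Suc j"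
      by (cases k) auto
    ultimately show "\<exists>k. n = (m - 1) + m * k"
      using m by (intro exI[of _ j]) simp
  next
    assume "\<exists>k. n = (m - 1) + m * k"
    then obtain k where "n = (m - 1) + m * k" ..
    then show "\<exists>k. Suc n = m * k"
      using m by (intro exI[of _ "Suc k"]) simp
  qed
  moreover have "A0 \<union> B0 = Suc -` (A \<union> B)"
    by (auto simp: A0_def B0_def)
  ultimately have un0: "A0 \<union> B0 = - {(m - 1) + m * k | k. True}"
    unfolding un True by auto
  have disj0: "A0 \<inter> B0 = {}"
    using disj by (auto simp: A0_def B0_def)
  have "0 \<in> A0 \<union> B0"
    unfolding un0 using m by auto
  moreover have "in_list (shift1 C) (shift1 D)"
    if "C \<union> D = A0 \<union> B0" "C \<inter> D = {}" "\<And>n. rep_count C n = rep_count D n" "0 \<in> C" for C D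
  proof -
    \<comment> \<open>The second family would require \<open>m = Suc (2 * (m - 1))\<close>, that is
      \<open>m = 1\<close>.\<close>
    have "\<exists>l. C = S1 l \<and> D = T1 l"
      using rep_count_eq_imp_S_T[of m "m - 1" C D] that un0 m by auto
    then show ?thesis
      unfolding in_list_def by blast
  qed
  ultimately have "in_list (shift1 A0) (shift1 B0) \<or> in_list (shift1 B0) (shift1 A0)"
    using disj0 rep0 by (metis Int_commute Un_commute Un_iff)
  then show ?thesis
    unfolding A B .
qed

theorem theorem1p1:
  fixes m r :: nat and A B :: "nat set"
  assumes "m \<ge> 2"
    and "A \<union> B = UNIV - {r + m * k | k. True}"
    and "A \<inter> B = {}"
  shows "(\<forall>n. n > 0 \<longrightarrow> rep_count A n = rep_count B n) \<longleftrightarrow> (in_list A B \<or> in_list B A)"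
proof
  assume pos: "\<forall>n. n > 0 \<longrightarrow> rep_count A n = rep_count B n"
  have "{(s, s'). s \<in> S \<and> s' \<in> S \<and> s < s' \<and> 0 = s + s'} = {}" for S :: "nat set"
    by auto
  then have "rep_count S 0 = 0" for S
    unfolding rep_count_def by (simp only: card.empty)
  with pos have "rep_count A n = rep_count B n" for n
    by (cases "n = 0") auto
  then show "in_list A B \<or> in_list B A"
    using assms by (intro in_list_if_rep_count_eq[of m A B r]) auto
next
  assume "in_list A B \<or> in_list B A"
  then show "\<forall>n. n > 0 \<longrightarrow> rep_count A n = rep_count B n"
    using rep_count_eq_if_in_list by metis
qed

end
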